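(* Let $f\in H^2$ be a function that is not a scalar multiple of $f_s(z)=(1-z)^s$ for any $s\in\mathbb{C}$. Then either $A_f$ is empty or $A_f=\{c^n:n\ge1\}$ for some $c\in(0,1)$.
   Context: $H^2=H^2(\mathbb{D})$ is the Hardy space of the open unit disk $\mathbb{D}$; $(1-z)^s$ is defined with the principal branch of the logarithm. For $a\in(0,1)$, $\phi_a(z)=az+(1-a)$ and $C_{\phi_a}f=f\circ\phi_a$ is a bounded operator on $H^2$. For non-zero $f\in H^2$, $A_f=\{a\in(0,1): f \text{ is an eigenvector of } C_{\phi_a}\}$. The zero function counts as a scalar multiple of every $f_s$. *)

theory Defs
  imports "HOL-Complex_Analysis.Complex_Analysis"
begin

text \<open>
  Elements of the Hardy space are represented by total functions on \<^typ>\<open>complex\<close>; only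
  their values on the open unit disk are relevant, so the operations below compare functions
  on the disk only.
\<close>

abbreviation unit_disk :: "complex set" where
  "unit_disk \<equiv> ball 0 1"

definition hardy2 :: "(complex \<Rightarrow> complex) set" where
  "hardy2 = {f. f holomorphic_on unit_disk \<and>
     bdd_above ((\<lambda>r. (1 / (2 * pi)) * integral {0..2 * pi} (\<lambda>t. (cmod (f (of_real r * cis t)))\<^sup>2))
                ` {0<..<1::real})}"

definition affine_symbol :: "real \<Rightarrow> complex \<Rightarrow> complex" where
  "affine_symbol a z = of_real a * z + (1 - of_real a)"

definition composition_operator ::
    "(complex \<Rightarrow> complex) \<Rightarrow> (complex \<Rightarrow> complex) \<Rightarrow> (complex \<Rightarrow> complex)" where
  "composition_operator \<phi> f = f \<circ> \<phi>"

definition hardy2_eigenvector ::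
    "((complex \<Rightarrow> complex) \<Rightarrow> (complex \<Rightarrow> complex)) \<Rightarrow> (complex \<Rightarrow> complex) \<Rightarrow> bool" where
  "hardy2_eigenvector T f \<longleftrightarrow>
     f \<in> hardy2 \<and> (\<exists>z\<in>unit_disk. f z \<noteq> 0) \<and>
     (\<exists>\<mu>::complex. \<forall>z\<in>unit_disk. T f z = \<mu> * f z)"

definition eigen_parameters :: "(complex \<Rightarrow> complex) \<Rightarrow> real set" where
  "eigen_parameters f =
     {a \<in> {0<..<1}. hardy2_eigenvector (composition_operator (affine_symbol a)) f}"

text \<open>
  Complex \<open>powr\<close> is defined through the principal branch \<^const>\<open>Ln\<close>; the base \<open>1 - z\<close> has
  positive real part on the disk.
\<close>

definition power_function :: "complex \<Rightarrow> complex \<Rightarrow> complex" where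
  "power_function s z = (1 - z) powr s"

end

theory Submission imports Defs begin

text \<open>
  The maps \<open>\<phi>\<^sub>a(z) = a z + (1 - a)\<close> compose like multiplication of parameters,
  \<open>\<phi>\<^sub>a \<circ> \<phi>\<^sub>b = \<phi>\<^sub>a\<^sub>b\<close>. Hence the set \<open>A\<close> of eigenparameters of a non-zero
  function \<open>f\<close> is closed under products, and, by the identity theorem, under those quotients that
  lie in \<open>(0,1)\<close> (\<open>eigen_parameters_mult\<close>, \<open>eigen_parameters_divide\<close>). Up to a logarithm, \<open>A\<close> is
  the negative half of a subgroup of the real line, so, when non-empty, it is either generated by
  a largest element \<open>c < 1\<close> (\<open>divisor_closed_set_eq_powers\<close>) or it accumulates at \<open>1\<close>.

  The second case forces \<open>f\<close> to be a multiple of a power of \<open>1 - z\<close>. Indeed, \<open>f \<circ> \<phi>\<^sub>a = \<mu> f\<close> gives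
  \<open>(f(\<phi>\<^sub>a(z)) - f(z)) / (a - 1) = (\<mu> - 1)/(a - 1) \<sqdot> f(z)\<close>. As \<open>a\<close> tends to \<open>1\<close> through \<open>A\<close>, the
  left side tends to \<open>(z - 1) f'(z)\<close>, so the factor \<open>(\<mu> - 1)/(a - 1)\<close>, which does not involve \<open>z\<close>,
  has a limit \<open>s\<close> (\<open>euler_equation_of_eigen_sequence\<close>). The resulting differential equation
  \<open>(z - 1) f' = s f\<close> has only the solutions \<open>k (1 - z)\<^sup>s\<close> (\<open>euler_equation_solution\<close>).
\<close>

section \<open>Multiplicatively closed subsets of the unit interval\<close>

text \<open>
  The discrete case of the dichotomy for subgroups of the real line, in multiplicative form. The
  supremum \<open>c\<close> of \<open>A\<close> is attained because two elements of \<open>A\<close> in \<open>(c\<^sup>2, c)\<close> would have a quotient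
  exceeding \<open>c\<close>; and an element strictly between \<open>c\<^sup>n\<^sup>+\<^sup>1\<close> and \<open>c\<^sup>n\<close> would, divided by \<open>c\<^sup>n\<close>, again
  exceed \<open>c\<close>.
\<close>

lemma divisor_closed_set_eq_powers:
  fixes A :: "real set"
  assumes sub: "A \<subseteq> {0<..<1}" and ne: "A \<noteq> {}"
    and mult: "\<And>a b. a \<in> A \<Longrightarrow> b \<in> A \<Longrightarrow> a * b \<in> A"
    and divide: "\<And>a b. a \<in> A \<Longrightarrow> b \<in> A \<Longrightarrow> a < b \<Longrightarrow> a / b \<in> A"
    and gap: "e < 1" "\<And>a. a \<in> A \<Longrightarrow> a \<le> e"
  shows "\<exists>c\<in>{0<..<1}. A = {c ^ n | n :: nat. n \<ge> 1}"
proof -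
  define c where "c = Sup A"
  have bdd: "bdd_above A"
    using gap(2) by (rule bdd_aboveI)
  have le_c: "a \<le> c" if "a \<in> A" for a
    unfolding c_def using that bdd by (rule cSup_upper)
  have "c \<le> e"
    unfolding c_def using ne gap(2) by (rule cSup_least)
  with gap(1) have c1: "c < 1" by simp
  obtain a0 where "a0 \<in> A" using ne by blast
  then have c0: "0 < c"
    using le_c[of a0] sub by force
  have cA: "c \<in> A"
  proof (rule ccontr)
    assume "c \<notin> A"
    have "c * c < Sup A"
      using c0 c1 unfolding c_def[symmetric] by simp
    then obtain a where a: "a \<in> A" "c * c < a"
      using less_cSup_iff[OF ne bdd] by blast
    have "a < c"
      using le_c[OF a(1)] a(1) \<open>c \<notin> A\<close> by (cases "a = c") auto
    then obtain b where b: "b \<in> A" "a < b"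
      unfolding c_def using less_cSup_iff[OF ne bdd] by blast
    have "0 < b" using b(1) sub by auto
    have "a \<le> c * b"
      using le_c[OF divide[OF a(1) b]] \<open>0 < b\<close> by (simp add: divide_le_eq)
    also have "\<dots> \<le> c * c"
      using le_c[OF b(1)] c0 by simp
    finally show False using a(2) by simp
  qed
  have pow: "c ^ Suc n \<in> A" for n
    by (induction n) (use cA mult in auto)
  have "\<exists>n\<ge>1. a = c ^ n" if a: "a \<in> A" for a
  proof -
    have "0 < a" using a sub by auto
    then have ex: "\<exists>n. c ^ Suc n < a"
      using real_arch_pow_inv[of a c] c0 c1
      by (meson less_imp_le lessI order.strict_trans1 power_decreasing)
    define n where "n = (LEAST n. c ^ Suc n < a)"
    have n: "c ^ Suc n < a"
      unfolding n_def using ex by (rule LeastI_ex)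
    have "n \<noteq> 0"
      using n le_c[OF a] by (cases n) auto
    then obtain m where m: "n = Suc m" by (cases n) auto
    have le: "a \<le> c ^ n"
      using not_less_Least[of m "\<lambda>n. c ^ Suc n < a"] m
      unfolding n_def[symmetric] by simp
    have "a = c ^ n"
    proof (rule ccontr)
      assume "a \<noteq> c ^ n"
      then have "a / c ^ n \<le> c"
        using le pow[of m] m by (intro le_c divide a) auto
      then show False
        using n c0 by (simp add: divide_le_eq)
    qed
    with \<open>n \<noteq> 0\<close> show ?thesis by (auto intro!: exI[of _ n])
  qed
  moreover have "c ^ n \<in> A" if "n \<ge> 1" for n
    using pow[of "n - 1"] that by simp
  ultimately have "A = {c ^ n | n :: nat. n \<ge> 1}"
    by blast
  with c0 c1 show ?thesis by auto
qed

section \<open>The semigroup of affine symbols\<close>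

lemma affine_symbol_comp:
  "affine_symbol a (affine_symbol b z) = affine_symbol (a * b) z"
  by (simp add: affine_symbol_def algebra_simps)

lemma affine_symbol_diff: "affine_symbol a z - z = (of_real a - 1) * (z - 1)"
  by (simp add: affine_symbol_def algebra_simps)

lemma affine_symbol_in_unit_disk:
  assumes "0 < a" "a < 1" "z \<in> unit_disk"
  shows "affine_symbol a z \<in> unit_disk"
proof -
  have "cmod (affine_symbol a z) \<le> cmod (of_real a * z) + cmod (of_real (1 - a))"
    unfolding affine_symbol_def using norm_triangle_ineq by (metis of_real_1 of_real_diff)
  also have "\<dots> = a * cmod z + (1 - a)"
    using assms by (simp only: norm_mult norm_of_real abs_of_pos diff_gt_0_iff_gt)
  also have "\<dots> < 1"
    using assms by simp
  finally show ?thesis by simp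
qed

lemma holomorphic_affine_symbol: "affine_symbol a holomorphic_on S"
  unfolding affine_symbol_def by (intro holomorphic_intros)

text \<open>
  \<open>\<phi>\<^sub>b\<close> has an open image, so a holomorphic function on the disk is determined by its values there.
\<close>

lemma holomorphic_eq_if_eq_on_affine_image:
  assumes g: "g holomorphic_on unit_disk" and h: "h holomorphic_on unit_disk"
    and b: "0 < b" "b < 1"
    and eq: "\<And>z. z \<in> unit_disk \<Longrightarrow> g (affine_symbol b z) = h (affine_symbol b z)"
    and z: "z \<in> unit_disk"
  shows "g z = h z"
proof -
  let ?U = "affine_symbol b ` unit_disk"
  have "open ?U"
  proof (rule open_mapping_thm3)
    show "inj_on (affine_symbol b) unit_disk"
      using b by (auto simp: inj_on_def affine_symbol_def)
  qed (simp_all add: holomorphic_affine_symbol)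
  moreover have "?U \<subseteq> unit_disk"
    using affine_symbol_in_unit_disk[OF b] by blast
  moreover have "affine_symbol b 0 \<in> ?U" by simp
  ultimately show ?thesis
    using eq by (intro analytic_continuation_open[OF _ _ _ _ _ g h _ z]) auto
qed

section \<open>Closure properties of the eigenparameters\<close>

lemma mem_eigen_parameters_iff:
  assumes "f \<in> hardy2" "\<exists>z\<in>unit_disk. f z \<noteq> 0"
  shows "a \<in> eigen_parameters f \<longleftrightarrow>
    0 < a \<and> a < 1 \<and> (\<exists>\<mu>. \<forall>z\<in>unit_disk. f (affine_symbol a z) = \<mu> * f z)"
  using assms by (auto simp: eigen_parameters_def hardy2_eigenvector_def composition_operator_def)

lemma eigen_parameters_mult:
  assumes f: "f \<in> hardy2" "\<exists>z\<in>unit_disk. f z \<noteq> 0"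
    and "a \<in> eigen_parameters f" "b \<in> eigen_parameters f"
  shows "a * b \<in> eigen_parameters f"
proof -
  from assms obtain \<mu> \<nu> where a: "0 < a" "a < 1"
    and \<mu>: "\<And>z. z \<in> unit_disk \<Longrightarrow> f (affine_symbol a z) = \<mu> * f z"
    and b: "0 < b" "b < 1"
    and \<nu>: "\<And>z. z \<in> unit_disk \<Longrightarrow> f (affine_symbol b z) = \<nu> * f z"
    unfolding mem_eigen_parameters_iff[OF f] by blast
  have "f (affine_symbol (a * b) z) = (\<mu> * \<nu>) * f z" if "z \<in> unit_disk" for z
    using \<mu>[OF affine_symbol_in_unit_disk[OF b that]] \<nu>[OF that]
    by (simp add: affine_symbol_comp)
  moreover have "a * b < 1 * 1"
    using a b by (intro mult_strict_mono) auto
  ultimately show ?thesis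
    unfolding mem_eigen_parameters_iff[OF f] using a b by auto
qed

text \<open>
  Since \<open>\<phi>\<^sub>a = \<phi>\<^sub>a\<^sub>/\<^sub>b \<circ> \<phi>\<^sub>b\<close>, the eigenvalue equation for \<open>a/b\<close> holds on the image of \<open>\<phi>\<^sub>b\<close>,
  hence on the whole disk. The eigenvalue for \<open>b\<close>, by which one divides, cannot vanish: otherwise
  \<open>f\<close> would vanish on that image.
\<close>

lemma eigen_parameters_divide:
  assumes f: "f \<in> hardy2" "\<exists>z\<in>unit_disk. f z \<noteq> 0"
    and "a \<in> eigen_parameters f" "b \<in> eigen_parameters f" and "a < b"
  shows "a / b \<in> eigen_parameters f"
proof -
  from assms obtain \<mu> \<nu> where a: "0 < a" "a < 1"
    and \<mu>: "\<And>z. z \<in> unit_disk \<Longrightarrow> f (affine_symbol a z) = \<mu> * f z"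
    and b: "0 < b" "b < 1"
    and \<nu>: "\<And>z. z \<in> unit_disk \<Longrightarrow> f (affine_symbol b z) = \<nu> * f z"
    unfolding mem_eigen_parameters_iff[OF f] by blast
  have hol: "f holomorphic_on unit_disk"
    using f(1) by (simp add: hardy2_def)
  have c: "0 < a / b" "a / b < 1"
    using a b \<open>a < b\<close> by auto
  have "\<nu> \<noteq> 0"
  proof
    assume "\<nu> = 0"
    then have "f z = 0" if "z \<in> unit_disk" for z
      using holomorphic_eq_if_eq_on_affine_image[OF hol holomorphic_on_const b _ that] \<nu>
      by simp
    with f(2) show False by blast
  qed
  have "f (affine_symbol (a / b) z) = (\<mu> / \<nu>) * f z" if "z \<in> unit_disk" for z
  proof (rule holomorphic_eq_if_eq_on_affine_image[OF _ _ b _ that])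
    have "(f \<circ> affine_symbol (a / b)) holomorphic_on unit_disk"
      using affine_symbol_in_unit_disk[OF c]
      by (intro holomorphic_on_compose_gen[OF holomorphic_affine_symbol hol]) auto
    then show "(\<lambda>z. f (affine_symbol (a / b) z)) holomorphic_on unit_disk"
      by (simp add: o_def)
    show "(\<lambda>z. (\<mu> / \<nu>) * f z) holomorphic_on unit_disk"
      using hol by (intro holomorphic_intros)
    show "f (affine_symbol (a / b) (affine_symbol b w)) = (\<mu> / \<nu>) * f (affine_symbol b w)"
      if "w \<in> unit_disk" for w
      using \<mu>[OF that] \<nu>[OF that] b \<open>\<nu> \<noteq> 0\<close> by (simp add: affine_symbol_comp)
  qed
  with c show ?thesis
    unfolding mem_eigen_parameters_iff[OF f] by blast
qed

section \<open>Eigenparameters accumulating at one\<close>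

text \<open>
  The difference quotients of \<open>f\<close> along \<open>\<phi>\<^sub>a(z) \<longlongrightarrow> z\<close> differ from \<open>f(z)\<close> by the factor
  \<open>(\<mu> - 1)/(a - 1)\<close>, which is the same at all points. Its convergence is read off at one point
  where \<open>f\<close> does not vanish and then used at every other point.
\<close>

lemma euler_equation_of_eigen_sequence:
  assumes hol: "f holomorphic_on unit_disk" and nz: "\<exists>z\<in>unit_disk. f z \<noteq> 0"
    and a1: "\<And>n. a n \<noteq> 1" and lim: "a \<longlonglongrightarrow> (1::real)"
    and eig: "\<And>n z. z \<in> unit_disk \<Longrightarrow> f (affine_symbol (a n) z) = \<mu> n * f z"
  shows "\<exists>s. \<forall>z\<in>unit_disk. (z - 1) * deriv f z = s * f z"
proof -
  define q where "q n = (\<mu> n - 1) / (of_real (a n) - 1)" for n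
  have q: "(\<lambda>n. q n * f z) \<longlonglongrightarrow> (z - 1) * deriv f z" if z: "z \<in> unit_disk" for z
  proof -
    have z1: "z \<noteq> 1" using z by auto
    have a1': "of_real (a n) \<noteq> (1 :: complex)" for n
      using a1[of n] by simp
    have "(f has_field_derivative deriv f z) (at z)"
      using hol z by (intro holomorphic_derivI[OF _ open_ball])
    then have D: "((\<lambda>w. (f w - f z) / (w - z)) \<longlongrightarrow> deriv f z) (at z)"
      by (simp add: has_field_derivative_iff)
    have "(\<lambda>n. affine_symbol (a n) z) \<longlonglongrightarrow> of_real 1 * z + (1 - of_real 1)"
      unfolding affine_symbol_def by (intro tendsto_intros lim)
    moreover have "affine_symbol (a n) z \<noteq> z" for n
      using affine_symbol_diff[of "a n" z] a1'[of n] z1 by auto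
    ultimately have "filterlim (\<lambda>n. affine_symbol (a n) z) (at z) sequentially"
      by (simp add: filterlim_at)
    then have "(\<lambda>n. (f (affine_symbol (a n) z) - f z) / (affine_symbol (a n) z - z))
        \<longlonglongrightarrow> deriv f z"
      by (rule filterlim_compose[OF D])
    then have "(\<lambda>n. (z - 1) * ((f (affine_symbol (a n) z) - f z) / (affine_symbol (a n) z - z)))
        \<longlonglongrightarrow> (z - 1) * deriv f z"
      by (rule tendsto_mult_left)
    moreover have "(z - 1) * ((f (affine_symbol (a n) z) - f z) / (affine_symbol (a n) z - z))
        = q n * f z" for n
    proof -
      have "f (affine_symbol (a n) z) - f z = (\<mu> n - 1) * f z"
        using eig[OF z] by (simp add: left_diff_distrib)
      then show ?thesis
        using z1 by (simp add: affine_symbol_diff q_def)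
    qed
    ultimately show ?thesis by simp
  qed
  obtain w where w: "w \<in> unit_disk" "f w \<noteq> 0" using nz by blast
  define s where "s = (w - 1) * deriv f w / f w"
  have "(\<lambda>n. q n * f w / f w) \<longlonglongrightarrow> s"
    unfolding s_def using w by (intro tendsto_divide q tendsto_const)
  then have "q \<longlonglongrightarrow> s"
    using w(2) by simp
  then have "(\<lambda>n. q n * f z) \<longlonglongrightarrow> s * f z" for z
    by (rule tendsto_mult_right)
  with q show ?thesis
    using LIMSEQ_unique by blast
qed

text \<open>By the equation, the quotient of \<open>f\<close> by the power function has derivative zero.\<close>

lemma euler_equation_solution:
  assumes hol: "f holomorphic_on unit_disk"
    and eq: "\<And>z. z \<in> unit_disk \<Longrightarrow> (z - 1) * deriv f z = s * f z"
  shows "\<exists>k. \<forall>z\<in>unit_disk. f z = k * power_function s z"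
proof -
  have slit: "1 - z \<notin> \<real>\<^sub>\<le>\<^sub>0" if "z \<in> unit_disk" for z
  proof -
    have "Re z < 1"
      using that complex_Re_le_cmod[of z] by simp
    then show ?thesis
      by (auto simp: complex_nonpos_Reals_iff)
  qed
  have "((\<lambda>z. f z * (1 - z) powr (-s)) has_field_derivative 0) (at z within unit_disk)"
    if z: "z \<in> unit_disk" for z
  proof -
    have z1: "1 - z \<noteq> 0" using z by auto
    have f': "(f has_field_derivative deriv f z) (at z)"
      using hol z by (intro holomorphic_derivI[OF _ open_ball])
    have "((\<lambda>z. f z * (1 - z) powr (-s)) has_field_derivative
        deriv f z * (1 - z) powr (-s) + f z * (s * (1 - z) powr (-s - 1))) (at z)"
      using slit[OF z] by (auto intro!: derivative_eq_intros f' simp: algebra_simps)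
    moreover have "deriv f z * (1 - z) powr (-s) + f z * (s * (1 - z) powr (-s - 1)) = 0"
    proof -
      have "(1 - z) powr (-s) = (1 - z) * (1 - z) powr (-s - 1)"
        using z1 by (simp add: powr_diff)
      then have "deriv f z * (1 - z) powr (-s) + f z * (s * (1 - z) powr (-s - 1))
          = (s * f z - (z - 1) * deriv f z) * (1 - z) powr (-s - 1)"
        by (subst \<open>(1 - z) powr (-s) = _\<close>) (simp add: algebra_simps)
      then show ?thesis using eq[OF z] by simp
    qed
    ultimately show ?thesis
      by (auto intro: has_field_derivative_at_within)
  qed
  then obtain k where k: "\<And>z. z \<in> unit_disk \<Longrightarrow> f z * (1 - z) powr (-s) = k"
    using has_field_derivative_zero_constant[of unit_disk "\<lambda>z. f z * (1 - z) powr (-s)"]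
    by auto
  have "f z = k * power_function s z" if "z \<in> unit_disk" for z
  proof -
    have "1 - z \<noteq> 0" using that by auto
    then have "(1 - z) powr (-s) * (1 - z) powr s = 1"
      by (simp add: powr_minus)
    then show ?thesis
      using k[OF that] by (metis mult.assoc mult.right_neutral power_function_def)
  qed
  then show ?thesis by blast
qed

section \<open>The structure of the set of eigenparameters\<close>

theorem theorem27:
  fixes f :: "complex \<Rightarrow> complex"
  assumes "f \<in> hardy2"
    and "\<not> (\<exists>s k :: complex. \<forall>z\<in>unit_disk. f z = k * power_function s z)"
  shows "eigen_parameters f = {} \<or>
         (\<exists>c\<in>{0<..<1::real}. eigen_parameters f = {c ^ n | n :: nat. n \<ge> 1})"
proof (cases "eigen_parameters f = {}")
  case False
  have hol: "f holomorphic_on unit_disk"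
    using assms(1) by (simp add: hardy2_def)
  have nz: "\<exists>z\<in>unit_disk. f z \<noteq> 0"
  proof (rule ccontr)
    assume "\<not> ?thesis"
    then have "\<forall>z\<in>unit_disk. f z = 0 * power_function 0 z" by simp
    with assms(2) show False by blast
  qed
  note mem = mem_eigen_parameters_iff[OF assms(1) nz]
  have "\<exists>e<1. \<forall>a\<in>eigen_parameters f. a \<le> e"
  proof (rule ccontr)
    assume no_gap: "\<not> ?thesis"
    have "\<exists>a. a \<in> eigen_parameters f \<and> 1 - inverse (real (Suc n)) < a" for n
    proof -
      have "1 - inverse (real (Suc n)) < 1" by simp
      with no_gap show ?thesis by (meson not_less)
    qed
    then obtain a where a: "\<And>n. a n \<in> eigen_parameters f"
      and a_gt: "\<And>n. 1 - inverse (real (Suc n)) < a n"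
      by metis
    have "\<exists>\<mu>. \<forall>n. \<forall>z\<in>unit_disk. f (affine_symbol (a n) z) = \<mu> n * f z"
      using a mem by (intro choice) blast
    then obtain \<mu> where \<mu>: "\<And>n z. z \<in> unit_disk \<Longrightarrow> f (affine_symbol (a n) z) = \<mu> n * f z"
      by blast
    have a_lt: "a n < 1" for n using a mem by blast
    have "(\<lambda>n. 1 - inverse (real (Suc n))) \<longlonglongrightarrow> 1 - 0"
      by (intro tendsto_diff tendsto_const LIMSEQ_inverse_real_of_nat)
    then have "(\<lambda>n. 1 - inverse (real (Suc n))) \<longlonglongrightarrow> 1" by simp
    then have "a \<longlonglongrightarrow> 1"
    proof (rule tendsto_sandwich[rotated 2])
      show "\<forall>\<^sub>F n in sequentially. 1 - inverse (real (Suc n)) \<le> a n"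
        using a_gt by (intro always_eventually allI less_imp_le)
      show "\<forall>\<^sub>F n in sequentially. a n \<le> 1"
        using a_lt by (intro always_eventually allI less_imp_le)
    qed (rule tendsto_const)
    moreover have "a n \<noteq> 1" for n using a_lt[of n] by simp
    ultimately obtain s where "\<forall>z\<in>unit_disk. (z - 1) * deriv f z = s * f z"
      using euler_equation_of_eigen_sequence[of f a \<mu>] hol nz \<mu> by blast
    then show False
      using euler_equation_solution[OF hol, of s] assms(2) by blast
  qed
  then obtain e where "e < 1" "\<And>a. a \<in> eigen_parameters f \<Longrightarrow> a \<le> e" by blast
  then have "\<exists>c\<in>{0<..<1}. eigen_parameters f = {c ^ n | n :: nat. n \<ge> 1}"
    using False eigen_parameters_mult[OF assms(1) nz] eigen_parameters_divide[OF assms(1) nz]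
    by (intro divisor_closed_set_eq_powers) (auto simp: mem)
  then show ?thesis by blast
qed simp

end
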